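(* Let $E=(x_E,y_E)\in\mathbb{R}^2$, let $\mathcal{D}(E)$ be the unit circle centered at $E$, and for $p\in\mathbb{R}\setminus\{0\}$ let $\mathcal{P}(p)$ be the parabola $y^2=2px+p^2$. Then $(\mathcal{D}(E),\mathcal{P}(p))$ is a $4$-Poncelet pair if and only if $x_E^2+y_E^2\neq 1$ and $$(x_E^2+y_E^2)\,p+x_E(x_E^2+y_E^2-1)=0.$$
   Context: Real conics are identified with their complexifications in $\mathbb{CP}^2$, and polygons are taken in $\mathbb{CP}^2$ (vertices and sides may be non-real). For $n\ge 3$ and two smooth conics $\mathcal{C}_1,\mathcal{C}_2$, an $n$-Poncelet polygon is an $n$-gon ($n$ distinct vertices, $n$ distinct side lines) whose vertices lie on $\mathcal{C}_1$ and whose side lines are tangent to $\mathcal{C}_2$; a $k$-gon traversed $m>1$ times is not regarded as an $mk$-gon. The pair $(\mathcal{C}_1,\mathcal{C}_2)$ is an $n$-Poncelet pair if such an $n$-gon exists. *)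

theory Defs
  imports "HOL-Analysis.Analysis"
begin

section \<open>The complex projective plane\<close>

text \<open>Points are nonzero vectors of homogeneous coordinates \<open>(X, Y, Z)\<close> up to a nonzero scalar;
  the affine point \<open>(x, y)\<close> is \<open>(x, y, 1)\<close>.\<close>

definition proj_rel :: "complex ^ 3 \<Rightarrow> complex ^ 3 \<Rightarrow> bool" where
  "proj_rel u v \<longleftrightarrow> u \<noteq> 0 \<and> v \<noteq> 0 \<and> (\<exists>c. c \<noteq> 0 \<and> v = c *s u)"

lemma part_equivp_proj_rel: "part_equivp proj_rel"
proof (rule part_equivpI)
  have "proj_rel (axis 1 1) (axis 1 1)"
    unfolding proj_rel_def by (auto simp: axis_eq_0_iff intro: exI[of _ 1])
  then show "\<exists>x. proj_rel x x" ..
  show "symp proj_rel"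
  proof (rule sympI)
    fix u v assume "proj_rel u v"
    then obtain c where c: "u \<noteq> 0" "v \<noteq> 0" "c \<noteq> 0" "v = c *s u"
      by (auto simp: proj_rel_def)
    then have "u = inverse c *s v" by (simp add: vector_smult_assoc)
    with c show "proj_rel v u"
      unfolding proj_rel_def by (metis inverse_nonzero_iff_nonzero)
  qed
  show "transp proj_rel"
    unfolding proj_rel_def by (rule transpI) (metis mult_eq_0_iff vector_smult_assoc)
qed

quotient_type cp2 = "complex ^ 3" / partial: proj_rel
  by (rule part_equivp_proj_rel)

lift_definition incident :: "complex ^ 3 \<Rightarrow> cp2 \<Rightarrow> bool" is
  "\<lambda>l u. (\<Sum>i\<in>UNIV. l $ i * u $ i) = 0"
proof -
  fix l u v :: "complex ^ 3"
  assume "proj_rel u v"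
  then obtain c where c: "c \<noteq> 0" "v = c *s u" by (auto simp: proj_rel_def)
  have "(\<Sum>i\<in>UNIV. l $ i * v $ i) = c * (\<Sum>i\<in>UNIV. l $ i * u $ i)"
    by (simp add: c sum_distrib_left algebra_simps)
  with c show "((\<Sum>i\<in>UNIV. l $ i * u $ i) = 0) = ((\<Sum>i\<in>UNIV. l $ i * v $ i) = 0)"
    by simp
qed

definition is_line :: "cp2 set \<Rightarrow> bool" where
  "is_line L \<longleftrightarrow> (\<exists>l. l \<noteq> 0 \<and> L = {P. incident l P})"


section \<open>Conics\<close>

text \<open>A conic is represented by a symmetric matrix \<open>A\<close>; its equation is \<open>bilin A u u = 0\<close>,
  and the gradient of the left-hand side at \<open>u\<close> is \<open>2 A u\<close>.\<close>

definition bilin :: "'a::comm_ring_1 ^ 'n ^ 'n \<Rightarrow> 'a ^ 'n \<Rightarrow> 'a ^ 'n \<Rightarrow> 'a" where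
  "bilin A u v = (\<Sum>i\<in>UNIV. u $ i * (A *v v) $ i)"

lemma matrix_vector_smult: "A *v (c *s v) = c *s (A *v v)" for c :: "'a::comm_ring_1"
  by (simp add: vec_eq_iff matrix_vector_mult_def sum_distrib_left algebra_simps)

lemma bilin_scale: "bilin A (c *s u) (d *s v) = c * d * bilin A u v"
  by (simp add: bilin_def matrix_vector_smult sum_distrib_left algebra_simps)

lift_definition conjugate :: "complex ^ 3 ^ 3 \<Rightarrow> cp2 \<Rightarrow> cp2 \<Rightarrow> bool" is
  "\<lambda>A u v. bilin A u v = 0"
  by (auto simp: proj_rel_def bilin_scale)

lift_definition gradient_vanishes :: "complex ^ 3 ^ 3 \<Rightarrow> cp2 \<Rightarrow> bool" is
  "\<lambda>A u. A *v u = 0"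
  by (auto simp: proj_rel_def matrix_vector_smult)

definition conic_points :: "complex ^ 3 ^ 3 \<Rightarrow> cp2 set" where
  "conic_points A = {P. conjugate A P P}"

definition smooth_conic :: "complex ^ 3 ^ 3 \<Rightarrow> bool" where
  "smooth_conic A \<longleftrightarrow> transpose A = A \<and> (\<forall>P\<in>conic_points A. \<not> gradient_vanishes A P)"

definition tangent_line :: "complex ^ 3 ^ 3 \<Rightarrow> cp2 \<Rightarrow> cp2 set" where
  "tangent_line A P = {Q. conjugate A Q P}"

definition tangent_to :: "cp2 set \<Rightarrow> complex ^ 3 ^ 3 \<Rightarrow> bool" where
  "tangent_to L A \<longleftrightarrow> (\<exists>P\<in>conic_points A. L = tangent_line A P)"


section \<open>Poncelet polygons\<close>

text \<open>\<open>v 0, \<dots>, v (n - 1)\<close> are the vertices; the side line \<open>l i\<close> joins \<open>v i\<close> to its cyclic successor.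
  Injectivity of the vertices excludes multiply traversed polygons.\<close>

definition is_polygon :: "nat \<Rightarrow> (nat \<Rightarrow> cp2) \<Rightarrow> (nat \<Rightarrow> cp2 set) \<Rightarrow> bool" where
  "is_polygon n v l \<longleftrightarrow> n \<ge> 3 \<and> inj_on v {..<n} \<and> inj_on l {..<n} \<and>
     (\<forall>i<n. is_line (l i) \<and> v i \<in> l i \<and> v (Suc i mod n) \<in> l i)"

definition poncelet_polygon ::
    "nat \<Rightarrow> complex ^ 3 ^ 3 \<Rightarrow> complex ^ 3 ^ 3 \<Rightarrow> (nat \<Rightarrow> cp2) \<Rightarrow> (nat \<Rightarrow> cp2 set) \<Rightarrow> bool" where
  "poncelet_polygon n A B v l \<longleftrightarrow> is_polygon n v l \<and>
     (\<forall>i<n. v i \<in> conic_points A \<and> tangent_to (l i) B)"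

definition poncelet_pair :: "nat \<Rightarrow> complex ^ 3 ^ 3 \<Rightarrow> complex ^ 3 ^ 3 \<Rightarrow> bool" where
  "poncelet_pair n A B \<longleftrightarrow> smooth_conic A \<and> smooth_conic B \<and> (\<exists>v l. poncelet_polygon n A B v l)"


section \<open>Real conics\<close>

definition real_conic :: "real \<Rightarrow> real \<Rightarrow> real \<Rightarrow> real \<Rightarrow> real \<Rightarrow> real \<Rightarrow> real ^ 3 ^ 3" where
  "real_conic a b c d e f =
     vector [vector [a, b / 2, d / 2], vector [b / 2, c, e / 2], vector [d / 2, e / 2, f]]"

definition real_locus :: "real ^ 3 ^ 3 \<Rightarrow> (real ^ 2) set" where
  "real_locus A = {z. bilin A (vector [z $ 1, z $ 2, 1]) (vector [z $ 1, z $ 2, 1]) = 0}"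

definition complexify :: "real ^ 3 ^ 3 \<Rightarrow> complex ^ 3 ^ 3" where
  "complexify A = (\<chi> i j. of_real (A $ i $ j))"

definition unit_circle :: "real ^ 2 \<Rightarrow> real ^ 3 ^ 3" where
  "unit_circle E = real_conic 1 0 1 (- 2 * E $ 1) (- 2 * E $ 2) ((E $ 1)\<^sup>2 + (E $ 2)\<^sup>2 - 1)"

definition parabola :: "real \<Rightarrow> real ^ 3 ^ 3" where
  "parabola p = real_conic 0 0 1 (- 2 * p) 0 (- p\<^sup>2)"

lemma real_locus_real_conic:
  "real_locus (real_conic a b c d e f) =
     {z. a * (z $ 1)\<^sup>2 + b * z $ 1 * z $ 2 + c * (z $ 2)\<^sup>2 + d * z $ 1 + e * z $ 2 + f = 0}"
  by (simp add: real_locus_def real_conic_def bilin_def matrix_vector_mult_def sum_3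
      algebra_simps power2_eq_square)

lemma real_locus_unit_circle: "real_locus (unit_circle E) = sphere E 1"
proof -
  have "z \<in> real_locus (unit_circle E) \<longleftrightarrow> (E $ 1 - z $ 1)\<^sup>2 + (E $ 2 - z $ 2)\<^sup>2 = 1" for z
    by (auto simp: unit_circle_def real_locus_real_conic power2_eq_square algebra_simps)
  moreover have "dist E z = 1 \<longleftrightarrow> (E $ 1 - z $ 1)\<^sup>2 + (E $ 2 - z $ 2)\<^sup>2 = 1" for z
    by (simp add: dist_vec_def L2_set_def sum_2 dist_real_def)
  ultimately show ?thesis by auto
qed

lemma real_locus_parabola: "real_locus (parabola p) = {z. (z $ 2)\<^sup>2 = 2 * p * z $ 1 + p\<^sup>2}"
  by (auto simp: parabola_def real_locus_real_conic)

end

theory Submission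
  imports Defs
begin

text \<open>In the coordinates \<open>z = x + i y\<close>, \<open>w = x - i y\<close> the circle is \<open>(z - e) (w - e') = 1\<close> with
  \<open>e = x\<^sub>E + i y\<^sub>E\<close>, \<open>e' = cnj e\<close>, so it is parametrised by \<open>z = e + u\<close>, \<open>w = e' + 1 / u\<close> with
  \<open>u = [a : b]\<close> in the projective line. Tangency of the chord \<open>u v\<close> to the parabola is a symmetric
  biquadratic equation \<open>F u v = 0\<close>. In a quadrilateral \<open>u\<^sub>0 u\<^sub>1 u\<^sub>2 u\<^sub>3\<close> the quadratic forms
  \<open>F u\<^sub>1\<close> and \<open>F u\<^sub>3\<close> share the roots \<open>u\<^sub>0, u\<^sub>2\<close>, hence are proportional; eliminating
  the elementary symmetric functions of \<open>u\<^sub>1, u\<^sub>3\<close> from this proportionality leaves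
  \<open>(e + e' + 2 p) e e' = e + e'\<close>, which is the stated equation.

  Conversely, the parabola has its focus at the origin, so it is tangent to the isotropic lines
  through the origin and to the line at infinity. If \<open>E \<noteq> 0\<close>, the quadrilateral on the
  two circular points and the residual intersections of the isotropic lines with the circle closes
  up. If \<open>E = 0\<close> it degenerates, but then \<open>F u v = 0\<close> reads \<open>u + 1/u + v + 1/v = - 2 p\<close>
  and \<open>u, v, 1/u, 1/v\<close> is a quadrilateral.\<close>

section \<open>Closed quadrilaterals of circle parameters\<close>

text \<open>A binary quadratic form with two distinct zeros \<open>[a : b]\<close>,
  \<open>[c : d]\<close> is a multiple of the product of the linear forms vanishing there.\<close>

lemma binary_form_roots:
  fixes a b c d x y z :: complex
  assumes 1: "x * a\<^sup>2 + y * a * b + z * b\<^sup>2 = 0" and 2: "x * c\<^sup>2 + y * c * d + z * d\<^sup>2 = 0"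
    and ne: "a * d - b * c \<noteq> 0"
  obtains k where "x = k * (b * d)" "y = - k * (a * d + b * c)" "z = k * (a * c)"
proof -
  define D where "D = a * d - b * c"
  \<comment> \<open>\<open>B\<close> is the polarised form at the two zeros. In the basis they form,
    only the cross term survives, which gives \<open>k = - B / D^2\<close>.\<close>
  define B where "B = 2 * x * a * c + y * (a * d + b * c) + 2 * z * b * d"
  have "x * D\<^sup>2 = - B * (b * d)" "y * D\<^sup>2 = B * (a * d + b * c)" "z * D\<^sup>2 = - B * (a * c)"
    unfolding D_def B_def using 1 2 by algebra+
  moreover have "D \<noteq> 0" using ne by (simp add: D_def)
  ultimately have "x = - B / D\<^sup>2 * (b * d)" "y = - (- B / D\<^sup>2) * (a * d + b * c)"
    "z = - B / D\<^sup>2 * (a * c)"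
    by (auto simp: field_simps)
  then show thesis by (rule that)
qed

definition det2 :: "complex \<times> complex \<Rightarrow> complex \<times> complex \<Rightarrow> complex" where
  "det2 u v = fst u * snd v - snd u * fst v"

text \<open>With \<open>\<gamma> = - (fst u * snd v + snd u * fst v) - e * \<alpha> - e' * \<beta>\<close> the chord is
  \<open>\<alpha> z + \<beta> w + \<gamma> = 0\<close>, and the parabola has the dual equation
  \<open>(\<alpha> + \<beta>) \<gamma> = 2 p \<alpha> \<beta>\<close>.\<close>

definition chord_tangency ::
    "complex \<Rightarrow> complex \<Rightarrow> complex \<Rightarrow> complex \<times> complex \<Rightarrow> complex \<times> complex \<Rightarrow> complex" where
  "chord_tangency e e' p u v =
     (let \<alpha> = snd u * snd v; \<beta> = fst u * fst v
      in (\<alpha> + \<beta>) * (fst u * snd v + snd u * fst v + e * \<alpha> + e' * \<beta>) + 2 * p * \<alpha> * \<beta>)"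

lemma chord_tangency_commute: "chord_tangency e e' p u v = chord_tangency e e' p v u"
  by (simp add: chord_tangency_def Let_def algebra_simps)

text \<open>For fixed \<open>(a, b)\<close> this is a quadratic form in \<open>(c, d)\<close>, ready
  for \<open>binary_form_roots\<close>.\<close>

lemma chord_tangency_expand:
  "chord_tangency e e' p (a, b) (c, d) =
     (a * b + e' * a\<^sup>2) * c\<^sup>2 + (a\<^sup>2 + (e + e' + 2 * p) * a * b + b\<^sup>2) * c * d + (a * b + e * b\<^sup>2) * d\<^sup>2"
  by (simp add: chord_tangency_def Let_def algebra_simps power2_eq_square)

definition tangent_quadrilateral where
  "tangent_quadrilateral e e' p u0 u1 u2 u3 \<longleftrightarrow>
     det2 u0 u1 \<noteq> 0 \<and> det2 u0 u2 \<noteq> 0 \<and> det2 u0 u3 \<noteq> 0 \<and>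
     det2 u1 u2 \<noteq> 0 \<and> det2 u1 u3 \<noteq> 0 \<and> det2 u2 u3 \<noteq> 0 \<and>
     chord_tangency e e' p u0 u1 = 0 \<and> chord_tangency e e' p u1 u2 = 0 \<and>
     chord_tangency e e' p u2 u3 = 0 \<and> chord_tangency e e' p u3 u0 = 0"

lemma tangent_quadrilateral_imp:
  assumes "tangent_quadrilateral e e' p u0 u1 u2 u3"
  shows "(e + e' + 2 * p) * (e * e') = e + e'"
proof -
  have t: "chord_tangency e e' p u0 u1 = 0" "chord_tangency e e' p u1 u2 = 0"
      "chord_tangency e e' p u2 u3 = 0" "chord_tangency e e' p u3 u0 = 0"
    and ne: "det2 u0 u2 \<noteq> 0" "det2 u1 u3 \<noteq> 0"
    using assms by (simp_all add: tangent_quadrilateral_def)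
  define m where "m = e + e' + 2 * p"
  obtain a b where u1: "u1 = (a, b)" by fastforce
  obtain c d where u3: "u3 = (c, d)" by fastforce
  obtain f g where u0: "u0 = (f, g)" by fastforce
  obtain h j where u2: "u2 = (h, j)" by fastforce
  have ne': "f * j - g * h \<noteq> 0" "a * d - b * c \<noteq> 0"
    using ne by (simp_all add: det2_def u0 u1 u2 u3)
  have t': "chord_tangency e e' p u1 u0 = 0" "chord_tangency e e' p u3 u2 = 0"
    using t chord_tangency_commute by metis+
  obtain k where k: "a * b + e' * a\<^sup>2 = k * (g * j)"
      "a\<^sup>2 + m * a * b + b\<^sup>2 = - k * (f * j + g * h)" "a * b + e * b\<^sup>2 = k * (f * h)"
    using binary_form_roots[OF t'(1)[unfolded u0 u1 chord_tangency_expand]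
        t(2)[unfolded u1 u2 chord_tangency_expand] ne'(1)]
    unfolding m_def by metis
  obtain l where l: "c * d + e' * c\<^sup>2 = l * (g * j)"
      "c\<^sup>2 + m * c * d + d\<^sup>2 = - l * (f * j + g * h)" "c * d + e * d\<^sup>2 = l * (f * h)"
    using binary_form_roots[OF t(4)[unfolded u0 u3 chord_tangency_expand]
        t'(2)[unfolded u3 u2 chord_tangency_expand] ne'(1)]
    unfolding m_def by metis
  \<comment> \<open>Homogeneous elementary symmetric functions of \<open>u1\<close> and
    \<open>u3\<close>.\<close>
  define P where "P = a * c"
  define S where "S = a * d + b * c"
  define R where "R = b * d"
  \<comment> \<open>A 2x2 minor of the two coefficient triples: alternating in \<open>u1\<close>,
    \<open>u3\<close>, hence divisible by \<open>a * d - b * c\<close>, with a quotient linear in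
    \<open>P\<close>, \<open>S\<close>, \<open>R\<close>. It vanishes because both triples are
    multiples of the same one. The other two minors follow below.\<close>
  have "(a * d - b * c) * (e' * P + e * e' * S + e * R) =
      (a * b + e' * a\<^sup>2) * (c * d + e * d\<^sup>2) - (c * d + e' * c\<^sup>2) * (a * b + e * b\<^sup>2)"
    unfolding P_def S_def R_def by algebra
  also have "\<dots> = 0" unfolding k l by algebra
  finally have 1: "e' * P + e * e' * S + e * R = 0" using ne' by simp
  have "(a * d - b * c) * (P + e * S + (m * e - 1) * R) =
      (a\<^sup>2 + m * a * b + b\<^sup>2) * (c * d + e * d\<^sup>2) - (c\<^sup>2 + m * c * d + d\<^sup>2) * (a * b + e * b\<^sup>2)"
    unfolding P_def S_def R_def by algebra
  also have "\<dots> = 0" unfolding k l by algebra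
  finally have 2: "P + e * S + (m * e - 1) * R = 0" using ne' by simp
  have "(a * d - b * c) * ((m * e' - 1) * P + e' * S + R) =
      (a * b + e' * a\<^sup>2) * (c\<^sup>2 + m * c * d + d\<^sup>2) - (c * d + e' * c\<^sup>2) * (a\<^sup>2 + m * a * b + b\<^sup>2)"
    unfolding P_def S_def R_def by algebra
  also have "\<dots> = 0" unfolding k l by algebra
  finally have 3: "(m * e' - 1) * P + e' * S + R = 0" using ne' by simp
  \<comment> \<open>Subtracting \<open>e'\<close> times equation 2, respectively \<open>e\<close>
    times equation 3, from equation 1 removes \<open>S\<close>.\<close>
  have R: "R * (e + e' - m * (e * e')) = 0" using 1 2 by algebra
  have P: "P * (e + e' - m * (e * e')) = 0" using 1 3 by algebra
  have "m * (e * e') = e + e'"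
  proof (cases "R = 0 \<and> P = 0")
    \<comment> \<open>Now \<open>u1\<close>, \<open>u3\<close> are the parameters 0 and infinity in
      some order; equations 2 and 3 reduce to \<open>e * S = 0\<close> and
      \<open>e' * S = 0\<close>, so \<open>e = e' = 0\<close>.\<close>
    case True
    then have "S \<noteq> 0" using ne' unfolding R_def P_def S_def by auto
    with True 2 3 show ?thesis by simp
  next
    case False
    with R P show ?thesis by auto
  qed
  then show ?thesis by (simp add: m_def)
qed


section \<open>Homogeneous coordinates, smoothness and the dual parabola\<close>

lemma proj_rel_refl: "u \<noteq> 0 \<Longrightarrow> proj_rel u u"
  unfolding proj_rel_def by (auto intro!: exI[of _ 1])

lemma incident_abs:
  "u \<noteq> 0 \<Longrightarrow> incident l (abs_cp2 u) \<longleftrightarrow> l $ 1 * u $ 1 + l $ 2 * u $ 2 + l $ 3 * u $ 3 = 0"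
  by (simp add: incident.abs_eq proj_rel_refl sum_3)

lemma conjugate_abs:
  "u \<noteq> 0 \<Longrightarrow> v \<noteq> 0 \<Longrightarrow> conjugate A (abs_cp2 u) (abs_cp2 v) \<longleftrightarrow> bilin A u v = 0"
  by (simp add: conjugate.abs_eq proj_rel_refl)

lemma gradient_vanishes_abs:
  "u \<noteq> 0 \<Longrightarrow> gradient_vanishes A (abs_cp2 u) \<longleftrightarrow> A *v u = 0"
  by (simp add: gradient_vanishes.abs_eq proj_rel_refl)

lemma cp2_cases:
  obtains u where "u \<noteq> 0" "P = abs_cp2 u"
  by (induction P rule: cp2.abs_induct) (auto simp: proj_rel_def)

lemma abs_cp2_scale:
  assumes "u \<noteq> 0" "c \<noteq> 0"
  shows "abs_cp2 (c *s u) = abs_cp2 u"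
proof -
  have "c *s u \<noteq> 0" using assms by (simp add: vec_eq_iff)
  with assms have "proj_rel u (c *s u)" by (auto simp: proj_rel_def)
  then show ?thesis using Quotient3_rel_abs[OF Quotient3_cp2] by metis
qed

lemma vec3_eq_0_iff: "u = 0 \<longleftrightarrow> u $ 1 = 0 \<and> u $ 2 = 0 \<and> u $ 3 = 0" for u :: "'a::zero ^ 3"
  by (simp add: vec_eq_iff forall_3)

lemma parabola_mult:
  "complexify (parabola p) *v u =
     vector [- of_real p * u $ 3, u $ 2, - of_real p * u $ 1 - (of_real p)\<^sup>2 * u $ 3]"
  by (simp add: vec_eq_iff forall_3 complexify_def parabola_def real_conic_def
      matrix_vector_mult_def sum_3 power2_eq_square)

lemma circle_mult:
  "complexify (unit_circle E) *v u =
     vector [u $ 1 - of_real (E $ 1) * u $ 3, u $ 2 - of_real (E $ 2) * u $ 3,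
       - of_real (E $ 1) * u $ 1 - of_real (E $ 2) * u $ 2
       + ((of_real (E $ 1))\<^sup>2 + (of_real (E $ 2))\<^sup>2 - 1) * u $ 3]"
  by (simp add: vec_eq_iff forall_3 complexify_def unit_circle_def real_conic_def
      matrix_vector_mult_def sum_3 power2_eq_square)

lemma transpose_complexify_real_conic:
  "transpose (complexify (real_conic a b c d e f)) = complexify (real_conic a b c d e f)"
  by (simp add: vec_eq_iff forall_3 transpose_def complexify_def real_conic_def)

lemma smooth_conic_iff:
  "smooth_conic A \<longleftrightarrow> transpose A = A \<and> (\<forall>u. u \<noteq> 0 \<longrightarrow> bilin A u u = 0 \<longrightarrow> A *v u \<noteq> 0)"
proof -
  have "(\<forall>P\<in>conic_points A. \<not> gradient_vanishes A P) \<longleftrightarrow>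
      (\<forall>u. u \<noteq> 0 \<longrightarrow> bilin A u u = 0 \<longrightarrow> A *v u \<noteq> 0)"
    unfolding conic_points_def using conjugate_abs gradient_vanishes_abs cp2_cases
    by (metis (no_types, lifting) mem_Collect_eq)
  then show ?thesis by (simp add: smooth_conic_def)
qed

lemma smooth_parabola: "p \<noteq> 0 \<Longrightarrow> smooth_conic (complexify (parabola p))"
  unfolding smooth_conic_iff parabola_mult
  by (auto simp: vec3_eq_0_iff parabola_def transpose_complexify_real_conic)

lemma smooth_circle: "smooth_conic (complexify (unit_circle E))"
proof -
  have "u = 0" if "complexify (unit_circle E) *v u = 0" for u
  proof -
    have 1: "u $ 1 = of_real (E $ 1) * u $ 3" "u $ 2 = of_real (E $ 2) * u $ 3"
      and 3: "- of_real (E $ 1) * u $ 1 - of_real (E $ 2) * u $ 2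
       + ((of_real (E $ 1))\<^sup>2 + (of_real (E $ 2))\<^sup>2 - 1) * u $ 3 = 0"
      using arg_cong[OF that, of "\<lambda>v. v $ 1"] arg_cong[OF that, of "\<lambda>v. v $ 2"]
        arg_cong[OF that, of "\<lambda>v. v $ 3"] unfolding circle_mult by simp_all
    have "u $ 3 = 0" using 1 3 by algebra
    with 1 show ?thesis by (simp add: vec3_eq_0_iff)
  qed
  then show ?thesis
    unfolding smooth_conic_iff by (auto simp: unit_circle_def transpose_complexify_real_conic)
qed

lemma tangent_line_parabola:
  assumes "t \<noteq> 0"
  shows "tangent_line (complexify (parabola p)) (abs_cp2 t) =
    {Q. incident (complexify (parabola p) *v t) Q}"
proof -
  have "conjugate (complexify (parabola p)) Q (abs_cp2 t) \<longleftrightarrow>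
      incident (complexify (parabola p) *v t) Q" for Q
  proof -
    obtain u where "u \<noteq> 0" "Q = abs_cp2 u" by (rule cp2_cases)
    then show ?thesis using assms
      by (simp add: conjugate_abs incident_abs bilin_def sum_3 mult.commute)
  qed
  then show ?thesis by (simp add: tangent_line_def)
qed

lemma bilin_parabola:
  "bilin (complexify (parabola p)) u u = (u $ 2)\<^sup>2 - 2 * of_real p * u $ 1 * u $ 3 - (of_real p)\<^sup>2 * (u $ 3)\<^sup>2"
  by (simp add: bilin_def parabola_mult sum_3 algebra_simps power2_eq_square)

text \<open>The quadratic condition on \<open>l\<close> is the dual conic: the matrix is invertible,
  so each line is the polar of a point, and it is tangent exactly when that pole lies on the
  parabola.\<close>

lemma tangent_to_parabola:
  assumes "p \<noteq> 0"
  shows "tangent_to L (complexify (parabola p)) \<longleftrightarrow>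
    (\<exists>l. l \<noteq> 0 \<and> L = {Q. incident l Q} \<and> of_real p * ((l $ 1)\<^sup>2 + (l $ 2)\<^sup>2) = 2 * l $ 1 * l $ 3)"
proof
  assume "tangent_to L (complexify (parabola p))"
  then obtain P where P: "P \<in> conic_points (complexify (parabola p))"
    "L = tangent_line (complexify (parabola p)) P" by (auto simp: tangent_to_def)
  obtain t where t: "t \<noteq> 0" "P = abs_cp2 t" by (rule cp2_cases)
  let ?l = "complexify (parabola p) *v t"
  have on: "bilin (complexify (parabola p)) t t = 0"
    using P t by (simp add: conic_points_def conjugate_abs)
  then have "?l \<noteq> 0" using t smooth_parabola[OF assms] by (simp add: smooth_conic_iff)
  moreover have "L = {Q. incident ?l Q}" using P t tangent_line_parabola by simp
  moreover have "of_real p * ((?l $ 1)\<^sup>2 + (?l $ 2)\<^sup>2) = 2 * ?l $ 1 * ?l $ 3"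
    using on unfolding bilin_parabola parabola_mult by simp algebra
  ultimately show "\<exists>l. l \<noteq> 0 \<and> L = {Q. incident l Q} \<and>
      of_real p * ((l $ 1)\<^sup>2 + (l $ 2)\<^sup>2) = 2 * l $ 1 * l $ 3" by blast
next
  assume "\<exists>l. l \<noteq> 0 \<and> L = {Q. incident l Q} \<and>
      of_real p * ((l $ 1)\<^sup>2 + (l $ 2)\<^sup>2) = 2 * l $ 1 * l $ 3"
  then obtain l where l: "l \<noteq> 0" "L = {Q. incident l Q}"
      "of_real p * ((l $ 1)\<^sup>2 + (l $ 2)\<^sup>2) = 2 * l $ 1 * l $ 3" by blast
  \<comment> \<open>The pole of \<open>l\<close>, that is, the inverse matrix applied to
    \<open>l\<close>.\<close>
  define t :: "complex ^ 3" where
    "t = vector [l $ 1 - l $ 3 / of_real p, l $ 2, - l $ 1 / of_real p]"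
  have Bt: "complexify (parabola p) *v t = l"
    using assms unfolding parabola_mult t_def
    by (simp add: vec_eq_iff forall_3 field_simps power2_eq_square)
  have t: "t \<noteq> 0" using Bt l(1) by auto
  have "bilin (complexify (parabola p)) t t = 0"
    using assms arg_cong[OF l(3), of "\<lambda>x. of_real p * x"] unfolding bilin_parabola t_def
    by (simp add: field_simps power2_eq_square)
  then show "tangent_to L (complexify (parabola p))"
    using t l(2) tangent_line_parabola[OF t] Bt
    unfolding tangent_to_def conic_points_def
    by (intro bexI[of _ "abs_cp2 t"]) (auto simp: conjugate_abs)
qed

section \<open>Rational parametrisation of the circle and its chords\<close>

text \<open>The coordinates are doubled to avoid denominators.\<close>

definition circle_vec :: "real ^ 2 \<Rightarrow> complex \<times> complex \<Rightarrow> complex ^ 3" where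
  "circle_vec E u = (case u of (a, b) \<Rightarrow>
     vector [2 * of_real (E $ 1) * a * b + a\<^sup>2 + b\<^sup>2,
             2 * of_real (E $ 2) * a * b - \<i> * (a\<^sup>2 - b\<^sup>2), 2 * a * b])"

definition center :: "real ^ 2 \<Rightarrow> complex" where
  "center E = Complex (E $ 1) (E $ 2)"

lemma center_eq: "center E = of_real (E $ 1) + \<i> * of_real (E $ 2)"
  "cnj (of_real (E $ 1) + \<i> * of_real (E $ 2)) = of_real (E $ 1) - \<i> * of_real (E $ 2)"
  by (simp_all add: center_def complex_eq_iff)

text \<open>The line \<open>\<alpha> z + \<beta> w + \<gamma> = 0\<close> rewritten in the Cartesian
  coordinates \<open>x\<close>, \<open>y\<close>.\<close>

definition chord_vec :: "real ^ 2 \<Rightarrow> complex \<times> complex \<Rightarrow> complex \<times> complex \<Rightarrow> complex ^ 3" where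
  "chord_vec E u v = (let \<alpha> = snd u * snd v; \<beta> = fst u * fst v
     in vector [\<alpha> + \<beta>, \<i> * (\<alpha> - \<beta>),
          - (fst u * snd v + snd u * fst v) - center E * \<alpha> - cnj (center E) * \<beta>])"

abbreviation circle_point :: "real ^ 2 \<Rightarrow> complex \<times> complex \<Rightarrow> cp2" where
  "circle_point E u \<equiv> abs_cp2 (circle_vec E u)"

lemma circle_vec_nonzero: "u \<noteq> 0 \<Longrightarrow> circle_vec E u \<noteq> 0"
  by (cases u) (auto simp: circle_vec_def vec3_eq_0_iff zero_prod_def)

lemma chord_vec_nonzero:
  assumes "u \<noteq> 0" "v \<noteq> 0"
  shows "chord_vec E u v \<noteq> 0"
proof
  assume "chord_vec E u v = 0"
  then have *: "snd u * snd v + fst u * fst v = 0" "snd u * snd v - fst u * fst v = 0"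
    "- (fst u * snd v + snd u * fst v) - center E * (snd u * snd v) - cnj (center E) * (fst u * fst v) = 0"
    unfolding vec3_eq_0_iff chord_vec_def Let_def vector_3 by auto
  then have "snd u * snd v = 0" "fst u * fst v = 0" by algebra+
  with * assms show False by (cases u; cases v) (auto simp: zero_prod_def)
qed

text \<open>Substituting the parametrisation into the linear form gives a quadratic in
  \<open>w\<close> that splits into the two determinants.\<close>

lemma incident_chord:
  assumes "w \<noteq> 0"
  shows "incident (chord_vec E u v) (circle_point E w) \<longleftrightarrow> det2 w u = 0 \<or> det2 w v = 0"
proof -
  obtain a b where u: "u = (a, b)" by fastforce
  obtain c d where v: "v = (c, d)" by fastforce
  obtain f g where w: "w = (f, g)" by fastforce
  have "chord_vec E u v $ 1 * circle_vec E w $ 1 + chord_vec E u v $ 2 * circle_vec E w $ 2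
      + chord_vec E u v $ 3 * circle_vec E w $ 3 = 2 * det2 w u * det2 w v"
    unfolding u v w chord_vec_def circle_vec_def det2_def Let_def center_eq prod.case
      fst_conv snd_conv vector_3
    using power2_i by algebra
  then show ?thesis using assms by (simp add: incident_abs circle_vec_nonzero)
qed

text \<open>The first two coordinates of the chord have square sum
  \<open>4 \<alpha> \<beta>\<close>, so the dual equation becomes twice
  \<open>chord_tangency\<close>.\<close>

lemma chord_vec_tangency:
  "of_real p * ((chord_vec E u v $ 1)\<^sup>2 + (chord_vec E u v $ 2)\<^sup>2) = 2 * chord_vec E u v $ 1 * chord_vec E u v $ 3
    \<longleftrightarrow> chord_tangency (center E) (cnj (center E)) (of_real p) u v = 0"
proof -
  have "of_real p * ((chord_vec E u v $ 1)\<^sup>2 + (chord_vec E u v $ 2)\<^sup>2) - 2 * chord_vec E u v $ 1 * chord_vec E u v $ 3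
      = 2 * chord_tangency (center E) (cnj (center E)) (of_real p) u v"
    unfolding chord_vec_def chord_tangency_def Let_def vector_3
    using power2_i by algebra
  then show ?thesis by (metis eq_iff_diff_eq_0 mult_eq_0_iff zero_neq_numeral)
qed

lemma circle_vec_on_circle: "bilin (complexify (unit_circle E)) (circle_vec E u) (circle_vec E u) = 0"
proof -
  obtain a b where u: "u = (a, b)" by fastforce
  show ?thesis
    unfolding u bilin_def circle_mult sum_3 circle_vec_def prod.case vector_3
    using power2_i by algebra
qed

lemma circle_point_eq_iff:
  assumes "u \<noteq> 0" "v \<noteq> 0"
  shows "circle_point E u = circle_point E v \<longleftrightarrow> det2 u v = 0"
proof
  assume "circle_point E u = circle_point E v"
  \<comment> \<open>The degenerate chord \<open>chord_vec E v v\<close> meets the circle only at the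
    point of \<open>v\<close>.\<close>
  then show "det2 u v = 0"
    using incident_chord[OF assms(1), of E v v] incident_chord[OF assms(2), of E v v]
    by (simp add: det2_def mult.commute)
next
  assume det: "det2 u v = 0"
  obtain a b where u: "u = (a, b)" by fastforce
  obtain c d where v: "v = (c, d)" by fastforce
  have ad: "a * d = b * c" using det by (simp add: det2_def u v)
  obtain k where k: "c = k * a" "d = k * b"
  proof (cases "a = 0")
    case True
    then show ?thesis using that[of "d / b"] ad assms(1) by (auto simp: u zero_prod_def)
  next
    case False
    then show ?thesis using that[of "c / a"] ad by (auto simp: field_simps)
  qed
  have "k \<noteq> 0" using assms k by (auto simp: v zero_prod_def)
  \<comment> \<open>The parametrisation is homogeneous of degree 2.\<close>
  moreover have "circle_vec E v = k\<^sup>2 *s circle_vec E u"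
    by (simp add: u v k circle_vec_def vec_eq_iff forall_3 field_simps power2_eq_square)
  ultimately show "circle_point E u = circle_point E v"
    using abs_cp2_scale[of "circle_vec E u" "k\<^sup>2"] circle_vec_nonzero assms by simp
qed

lemma conic_points_circle:
  "conic_points (complexify (unit_circle E)) = circle_point E ` {u. u \<noteq> 0}"
proof (intro equalityI subsetI)
  fix P assume "P \<in> conic_points (complexify (unit_circle E))"
  moreover obtain q where q: "q \<noteq> 0" "P = abs_cp2 q" by (rule cp2_cases)
  ultimately have on: "bilin (complexify (unit_circle E)) q q = 0"
    by (simp add: conic_points_def conjugate_abs)
  \<comment> \<open>In isotropic coordinates centred at \<open>E\<close> the circle is
    \<open>z * w = (q $ 3)^2\<close>, so \<open>[z : q $ 3]\<close> recovers the parameter.\<close>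
  define z where "z = q $ 1 + \<i> * q $ 2 - center E * q $ 3"
  define w where "w = q $ 1 - \<i> * q $ 2 - cnj (center E) * q $ 3"
  have zw: "z * w = (q $ 3)\<^sup>2"
    using on unfolding z_def w_def center_eq bilin_def circle_mult sum_3 vector_3
    using power2_i by algebra
  have q1: "2 * q $ 1 = z + w + 2 * of_real (E $ 1) * q $ 3"
    and q2: "2 * q $ 2 = - \<i> * (z - w) + 2 * of_real (E $ 2) * q $ 3"
    unfolding z_def w_def center_eq by (simp_all add: algebra_simps)
  have "\<exists>u k. u \<noteq> 0 \<and> k \<noteq> 0 \<and> circle_vec E u = k *s q"
  proof (cases "z = 0")
    \<comment> \<open>Here the pair \<open>(z, q $ 3)\<close> is zero; the point is the circular
      point with parameter \<open>[0 : 1]\<close>.\<close>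
    case True
    then have q3: "q $ 3 = 0" using zw by simp
    have "w \<noteq> 0" using True q3 q1 q2 q(1) by (auto simp: vec3_eq_0_iff)
    moreover have "circle_vec E (0, 1) = (2 / w) *s q"
      using q1 q2 q3 True \<open>w \<noteq> 0\<close>
      by (simp add: circle_vec_def vec_eq_iff forall_3 field_simps)
    ultimately show ?thesis by (intro exI[of _ "(0, 1)"] exI[of _ "2 / w"]) (simp add: zero_prod_def)
  next
    case False
    have "circle_vec E (z, q $ 3) $ 1 = 2 * z * q $ 1" "circle_vec E (z, q $ 3) $ 2 = 2 * z * q $ 2"
      using q1 q2 zw unfolding circle_vec_def prod.case vector_3 by algebra+
    then have "circle_vec E (z, q $ 3) = (2 * z) *s q"
      by (simp add: vec_eq_iff forall_3) (simp add: circle_vec_def)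
    with False show ?thesis by (intro exI[of _ "(z, q $ 3)"] exI[of _ "2 * z"]) (simp add: zero_prod_def)
  qed
  then show "P \<in> circle_point E ` {u. u \<noteq> 0}"
    using abs_cp2_scale[OF q(1)] q(2) by (metis (mono_tags, lifting) imageI mem_Collect_eq)
next
  fix P assume "P \<in> circle_point E ` {u. u \<noteq> 0}"
  then show "P \<in> conic_points (complexify (unit_circle E))"
    by (auto simp: conic_points_def conjugate_abs circle_vec_nonzero circle_vec_on_circle)
qed

text \<open>Restricted to the circle, the equation of \<open>L\<close> is a binary form with zeros
  \<open>u\<close> and \<open>v\<close>, so \<open>L\<close> must be their chord.\<close>

lemma tangent_side_imp:
  assumes p: "p \<noteq> 0" and L: "tangent_to L (complexify (parabola p))"
    and u: "circle_point E u \<in> L" and v: "circle_point E v \<in> L" and ne: "det2 u v \<noteq> 0"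
  shows "chord_tangency (center E) (cnj (center E)) (of_real p) u v = 0"
proof -
  obtain l where l: "l \<noteq> 0" "L = {Q. incident l Q}"
    "of_real p * ((l $ 1)\<^sup>2 + (l $ 2)\<^sup>2) = 2 * l $ 1 * l $ 3"
    using L tangent_to_parabola[OF p] by blast
  \<comment> \<open>Coefficients of the restricted form; matching them with those of the chord
    yields \<open>2 l = k * chord_vec E u v\<close>.\<close>
  define x where "x = l $ 1 - \<i> * l $ 2"
  define y where "y = 2 * (l $ 1 * of_real (E $ 1) + l $ 2 * of_real (E $ 2) + l $ 3)"
  define z where "z = l $ 1 + \<i> * l $ 2"
  have form: "x * (fst w)\<^sup>2 + y * fst w * snd w + z * (snd w)\<^sup>2 = 0"
    if "w \<noteq> 0" "circle_point E w \<in> L" for w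
    using that l(2) incident_abs[OF circle_vec_nonzero[OF that(1)], of l E]
    by (simp add: circle_vec_def split_beta x_def y_def z_def algebra_simps)
  have "u \<noteq> 0" "v \<noteq> 0" using ne by (auto simp: det2_def)
  then obtain k where k: "x = k * (snd u * snd v)" "y = - k * (fst u * snd v + snd u * fst v)"
      "z = k * (fst u * fst v)"
    using binary_form_roots[OF form[of u] form[of v]] u v ne unfolding det2_def by metis
  have "2 * l $ 1 = x + z" unfolding x_def z_def by simp
  then have l1: "2 * l $ 1 = k * chord_vec E u v $ 1"
    unfolding k chord_vec_def Let_def vector_3 by algebra
  have "2 * l $ 2 = \<i> * (x - z)" unfolding x_def z_def by (simp add: algebra_simps)
  then have l2: "2 * l $ 2 = k * chord_vec E u v $ 2"
    unfolding k chord_vec_def Let_def vector_3 by algebra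
  have "2 * l $ 3 = y - (2 * l $ 1) * of_real (E $ 1) - (2 * l $ 2) * of_real (E $ 2)"
    unfolding y_def by algebra
  then have l3: "2 * l $ 3 = k * chord_vec E u v $ 3"
    unfolding l1 l2 k chord_vec_def Let_def vector_3 center_eq using power2_i by algebra
  have "k \<noteq> 0" using l(1) l1 l2 l3 by (auto simp: vec3_eq_0_iff)
  moreover have "k\<^sup>2 * (of_real p * ((chord_vec E u v $ 1)\<^sup>2 + (chord_vec E u v $ 2)\<^sup>2)) =
      k\<^sup>2 * (2 * chord_vec E u v $ 1 * chord_vec E u v $ 3)"
    using l(3) l1 l2 l3 by algebra
  ultimately show ?thesis using chord_vec_tangency[of p E u v] by simp
qed

section \<open>Passage between Poncelet polygons and parameters\<close>

lemma poncelet_polygonI: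
  fixes u :: "nat \<Rightarrow> complex \<times> complex"
  assumes p: "p \<noteq> 0" and n: "n \<ge> 3"
    and ne: "\<And>i j. i < n \<Longrightarrow> j < n \<Longrightarrow> i \<noteq> j \<Longrightarrow> det2 (u i) (u j) \<noteq> 0"
    and tang: "\<And>i. i < n \<Longrightarrow>
      chord_tangency (center E) (cnj (center E)) (of_real p) (u i) (u (Suc i mod n)) = 0"
  shows "poncelet_polygon n (complexify (unit_circle E)) (complexify (parabola p))
    (\<lambda>i. circle_point E (u i)) (\<lambda>i. {Q. incident (chord_vec E (u i) (u (Suc i mod n))) Q})"
proof -
  let ?s = "\<lambda>i. Suc i mod n"
  let ?v = "\<lambda>i. circle_point E (u i)"
  let ?l = "\<lambda>i. {Q. incident (chord_vec E (u i) (u (?s i))) Q}"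
  have s: "?s i < n" for i using n by simp
  have s_ne: "?s i \<noteq> i" if "i < n" for i using that n by (auto simp: mod_Suc)
  have nz: "u i \<noteq> 0" if "i < n" for i
    using ne[OF that s[of i]] s_ne[OF that] by (auto simp: det2_def)
  have det0: "det2 (u i) (u j) = 0 \<longleftrightarrow> i = j" if "i < n" "j < n" for i j
    using ne[OF that] by (auto simp: det2_def)
  have on_side: "?v j \<in> ?l i \<longleftrightarrow> j = i \<or> j = ?s i" if "i < n" "j < n" for i j
    using that s by (simp add: incident_chord nz det0)
  have "inj_on ?v {..<n}"
    by (intro inj_onI) (simp add: circle_point_eq_iff nz det0)
  moreover have "inj_on ?l {..<n}"
  proof (intro inj_onI)
    fix i j assume ij: "i \<in> {..<n}" "j \<in> {..<n}" and eq: "?l i = ?l j"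
    \<comment> \<open>Equal side lines contain the same vertices, and side \<open>i\<close> contains
      only vertices \<open>i\<close> and \<open>?s i\<close>. As \<open>n >= 3\<close>, two
      different sides cannot share both.\<close>
    have "j = i \<or> j = ?s i" "?s j = i \<or> ?s j = ?s i"
      using on_side[of j j] on_side[of i j] on_side[of j "?s j"] on_side[of i "?s j"] s ij eq by auto
    then show "i = j" using ij n by (auto simp: mod_Suc split: if_splits)
  qed
  moreover have "is_line (?l i) \<and> ?v i \<in> ?l i \<and> ?v (?s i) \<in> ?l i" if "i < n" for i
    using that s nz chord_vec_nonzero[OF nz[OF that] nz[OF s[of i]]] on_side
    unfolding is_line_def by blast
  moreover have "?v i \<in> conic_points (complexify (unit_circle E))" if "i < n" for i
    using nz[OF that] by (auto simp: conic_points_circle)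
  moreover have "tangent_to (?l i) (complexify (parabola p))" if "i < n" for i
    unfolding tangent_to_parabola[OF p]
    using chord_vec_nonzero[OF nz[OF that] nz[OF s[of i]]] chord_vec_tangency tang[OF that] by blast
  ultimately show ?thesis using n by (simp add: poncelet_polygon_def is_polygon_def)
qed

lemma all_less_4: "(\<forall>i<4. P i) \<longleftrightarrow> P 0 \<and> P 1 \<and> P 2 \<and> P (3::nat)"
  by (simp add: eval_nat_numeral All_less_Suc conj_ac)

lemma poncelet_4_iff:
  assumes p: "p \<noteq> 0"
  shows "poncelet_pair 4 (complexify (unit_circle E)) (complexify (parabola p)) \<longleftrightarrow>
    (\<exists>u0 u1 u2 u3. tangent_quadrilateral (center E) (cnj (center E)) (of_real p) u0 u1 u2 u3)"
    (is "_ \<longleftrightarrow> ?R")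
proof
  assume "poncelet_pair 4 (complexify (unit_circle E)) (complexify (parabola p))"
  then obtain v l where "poncelet_polygon 4 (complexify (unit_circle E)) (complexify (parabola p)) v l"
    by (auto simp: poncelet_pair_def)
  then have inj: "inj_on v {..<4}"
    and inc: "\<And>i. i < 4 \<Longrightarrow> v i \<in> l i" "\<And>i. i < 4 \<Longrightarrow> v (Suc i mod 4) \<in> l i"
    and con: "\<And>i. i < 4 \<Longrightarrow> v i \<in> circle_point E ` {u. u \<noteq> 0}"
    and tang: "\<And>i. i < 4 \<Longrightarrow> tangent_to (l i) (complexify (parabola p))"
    by (auto simp: poncelet_polygon_def is_polygon_def conic_points_circle)
  have "\<forall>i. \<exists>u. i < 4 \<longrightarrow> u \<noteq> 0 \<and> v i = circle_point E u" using con by blast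
  then obtain u where u: "\<And>i. i < 4 \<Longrightarrow> u i \<noteq> 0" "\<And>i. i < 4 \<Longrightarrow> v i = circle_point E (u i)"
    by metis
  have ne: "det2 (u i) (u j) \<noteq> 0" if "i < 4" "j < 4" "i \<noteq> j" for i j
    using that inj u circle_point_eq_iff[of "u i" "u j" E] by (metis inj_onD lessThan_iff)
  have ct: "chord_tangency (center E) (cnj (center E)) (of_real p) (u i) (u (Suc i mod 4)) = 0"
    if "i < 4" for i
  proof (rule tangent_side_imp[OF p tang[OF that]])
    show "circle_point E (u i) \<in> l i" using inc(1)[OF that] u(2)[OF that] by simp
    show "circle_point E (u (Suc i mod 4)) \<in> l i" using inc(2)[OF that] u(2)[of "Suc i mod 4"] by simp
    show "det2 (u i) (u (Suc i mod 4)) \<noteq> 0" using that by (intro ne) (auto simp: mod_Suc)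
  qed
  have "Suc 0 mod 4 = 1" "Suc 1 mod 4 = 2" "Suc 2 mod 4 = 3" "Suc 3 mod 4 = 0" by simp_all
  note ct' = ct[of 0, unfolded this] ct[of 1, unfolded this] ct[of 2, unfolded this] ct[of 3, unfolded this]
  have "tangent_quadrilateral (center E) (cnj (center E)) (of_real p) (u 0) (u 1) (u 2) (u 3)"
    using ne[of 0 1] ne[of 0 2] ne[of 0 3] ne[of 1 2] ne[of 1 3] ne[of 2 3]
      ct' by (simp add: tangent_quadrilateral_def)
  then show ?R by blast
next
  assume ?R
  then obtain u0 u1 u2 u3 where q: "tangent_quadrilateral (center E) (cnj (center E)) (of_real p) u0 u1 u2 u3"
    by blast
  have swap: "det2 x y = - det2 y x" for x y by (simp add: det2_def)
  define u where "u = (!) [u0, u1, u2, u3]"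
  have "\<forall>i<4. \<forall>j<4. i \<noteq> j \<longrightarrow> det2 (u i) (u j) \<noteq> 0"
    unfolding all_less_4 using q swap[of u1 u0] swap[of u2 u0] swap[of u3 u0] swap[of u2 u1]
      swap[of u3 u1] swap[of u3 u2]
    by (simp add: u_def tangent_quadrilateral_def)
  moreover have "\<forall>i<4. chord_tangency (center E) (cnj (center E)) (of_real p) (u i) (u (Suc i mod 4)) = 0"
    unfolding all_less_4 using q by (simp add: u_def tangent_quadrilateral_def)
  ultimately have "poncelet_polygon 4 (complexify (unit_circle E)) (complexify (parabola p))
      (\<lambda>i. circle_point E (u i)) (\<lambda>i. {Q. incident (chord_vec E (u i) (u (Suc i mod 4))) Q})"
    by (intro poncelet_polygonI[OF p]) auto
  then show "poncelet_pair 4 (complexify (unit_circle E)) (complexify (parabola p))"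
    using smooth_circle smooth_parabola[OF p] unfolding poncelet_pair_def by blast
qed

section \<open>Existence of quadrilaterals\<close>

lemma quadratic_root:
  obtains x :: complex where "x\<^sup>2 + b * x + c = 0"
proof -
  define q where "q = csqrt (b\<^sup>2 - 4 * c)"
  define x where "x = (q - b) / 2"
  have "q\<^sup>2 = b\<^sup>2 - 4 * c" by (simp add: q_def)
  moreover have "2 * x = q - b" by (simp add: x_def)
  ultimately have "4 * (x\<^sup>2 + b * x + c) = 0" by algebra
  then have "x\<^sup>2 + b * x + c = 0" by (metis mult_eq_0_iff zero_neq_numeral)
  then show thesis by (rule that)
qed

lemma tangent_quadrilateral_at_focus:
  assumes "p \<noteq> (0::real)"
  obtains u0 u1 u2 u3 where "tangent_quadrilateral 0 0 (of_real p) u0 u1 u2 u3"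
proof -
  \<comment> \<open>Any generic value of \<open>s + 1 / s\<close> would do; \<open>\<i>\<close> avoids the finitely many bad values,
    which are all real.\<close>
  obtain s where s: "s\<^sup>2 + (- \<i>) * s + 1 = 0" by (rule quadratic_root)
  \<comment> \<open>Thus \<open>s + 1/s = \<i>\<close> and \<open>t + 1/t = - 2 p - \<i>\<close>,
    with the sum required for tangency. Facts 1 to 4 below make \<open>s\<close>, \<open>t\<close>,
    \<open>1/s\<close>, \<open>1/t\<close> pairwise distinct.\<close>
  obtain t where t: "t\<^sup>2 + (2 * of_real p + \<i>) * t + 1 = 0" by (rule quadratic_root)
  have 1: "s\<^sup>2 \<noteq> 1"
  proof
    assume "s\<^sup>2 = 1"
    with s have "\<i> * s = 2" by algebra
    then have "(\<i> * s)\<^sup>2 = 4" by simp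
    with \<open>s\<^sup>2 = 1\<close> show False by (simp add: power_mult_distrib)
  qed
  have 2: "t\<^sup>2 \<noteq> 1"
  proof
    \<comment> \<open>Then \<open>2 p + \<i>\<close> would be 2 or -2, but its square has imaginary
      part \<open>4 p\<close>.\<close>
    assume "t\<^sup>2 = 1"
    with t have "(2 * of_real p + \<i>)\<^sup>2 = (4::complex)" by algebra
    then have "Im ((2 * of_real p + \<i>)\<^sup>2) = 0" by simp
    with assms show False by (simp add: power2_eq_square)
  qed
  have p_i: "of_real p + \<i> \<noteq> (0::complex)" by (simp add: complex_eq_iff)
  have 3: "s \<noteq> t"
  proof
    assume "s = t"
    then have "(s\<^sup>2 + (2 * of_real p + \<i>) * s + 1) - (s\<^sup>2 + (- \<i>) * s + 1) = 0" using s t by simp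
    then have "(of_real p + \<i>) * s = 0" by algebra
    with p_i s show False by auto
  qed
  have 4: "s * t \<noteq> 1"
  proof
    assume st: "s * t = 1"
    have "(of_real p + \<i>) * 2 = 0" using st s t by algebra
    with p_i show False by (metis mult_eq_0_iff zero_neq_numeral)
  qed
  \<comment> \<open>One equation serves all four sides, since inverting \<open>s\<close> or
    \<open>t\<close> preserves the tangency condition.\<close>
  have e: "s * t * (2 * of_real p + s + t) + s + t = 0" using s t by algebra
  have "tangent_quadrilateral 0 0 (of_real p) (s, 1) (t, 1) (1, s) (1, t)"
    using 1 2 3 4 e
    by (simp add: tangent_quadrilateral_def det2_def chord_tangency_def algebra_simps power2_eq_square)
  then show thesis by (rule that)
qed

text \<open>The first two vertices are the circular points; \<open>(- e, 1)\<close> has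
  \<open>z = 0\<close> and \<open>(1, - e')\<close> has \<open>w = 0\<close>. Three sides are the
  line at infinity and the isotropic lines \<open>z = 0\<close>, \<open>w = 0\<close>; the
  hypothesis \<open>c\<close> is tangency of the remaining one. The inequalities keep the vertices
  distinct.\<close>

lemma tangent_quadrilateral_off_focus:
  assumes e: "e \<noteq> 0" "e' \<noteq> 0" "e * e' \<noteq> 1" and c: "(e + e' + 2 * p) * (e * e') = e + e'"
  shows "tangent_quadrilateral e e' p (1, 0) (0, 1) (- e, 1) (1, - e')"
proof -
  have "chord_tangency e e' p (- e, 1) (1, - e') = 0"
    using c unfolding chord_tangency_def Let_def fst_conv snd_conv by algebra
  then show ?thesis using e
    by (simp add: tangent_quadrilateral_def det2_def chord_tangency_def)
qed

theorem proposition3p2: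
  fixes E :: "real ^ 2" and x\<^sub>E y\<^sub>E p :: real
  assumes "x\<^sub>E = E $ 1" and "y\<^sub>E = E $ 2" and "p \<noteq> 0"
  shows "poncelet_pair 4 (complexify (unit_circle E)) (complexify (parabola p)) \<longleftrightarrow>
    x\<^sub>E\<^sup>2 + y\<^sub>E\<^sup>2 \<noteq> 1 \<and>
    (x\<^sub>E\<^sup>2 + y\<^sub>E\<^sup>2) * p + x\<^sub>E * (x\<^sub>E\<^sup>2 + y\<^sub>E\<^sup>2 - 1) = 0"
proof -
  define e where "e = center E"
  define N where "N = x\<^sub>E\<^sup>2 + y\<^sub>E\<^sup>2"
  have sum: "e + cnj e = of_real (2 * x\<^sub>E)"
    by (simp add: e_def center_def assms complex_eq_iff)
  have prod: "e * cnj e = of_real N"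
    unfolding e_def N_def center_def assms by (simp add: complex_mult_cnj)
  have "(e + cnj e + 2 * of_real p) * (e * cnj e) - (e + cnj e) = of_real (2 * (N * p + x\<^sub>E * (N - 1)))"
    unfolding sum prod by (simp add: algebra_simps)
  then have cond: "(e + cnj e + 2 * of_real p) * (e * cnj e) = e + cnj e \<longleftrightarrow> N * p + x\<^sub>E * (N - 1) = 0"
    by (metis eq_iff_diff_eq_0 mult_eq_0_iff of_real_eq_0_iff zero_neq_numeral)
  show ?thesis unfolding N_def[symmetric]
  proof
    assume "poncelet_pair 4 (complexify (unit_circle E)) (complexify (parabola p))"
    then have "N * p + x\<^sub>E * (N - 1) = 0"
      unfolding poncelet_4_iff[OF assms(3)] cond[symmetric] e_def using tangent_quadrilateral_imp by blast
    \<comment> \<open>\<open>N = 1\<close>, the focus lying on the circle, would reduce the equation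
      to \<open>p = 0\<close>.\<close>
    moreover from this have "N \<noteq> 1" using assms(3) by auto
    ultimately show "N \<noteq> 1 \<and> N * p + x\<^sub>E * (N - 1) = 0" by blast
  next
    assume N: "N \<noteq> 1 \<and> N * p + x\<^sub>E * (N - 1) = 0"
    show "poncelet_pair 4 (complexify (unit_circle E)) (complexify (parabola p))"
    proof (cases "e = 0")
      case True
      then show ?thesis
        unfolding poncelet_4_iff[OF assms(3)] e_def
        using tangent_quadrilateral_at_focus[OF assms(3)] by (metis complex_cnj_zero)
    next
      case False
      have "e * cnj e \<noteq> 1" using N by (simp add: prod)
      with False have "tangent_quadrilateral e (cnj e) (of_real p) (1, 0) (0, 1) (- e, 1) (1, - cnj e)"
        using cond N by (intro tangent_quadrilateral_off_focus) auto
      then show ?thesis unfolding poncelet_4_iff[OF assms(3)] e_def by blast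
    qed
  qed
qed

end
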